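(* Let $S=\langle d_1,\dots,d_m\rangle$ be a numerical semigroup with minimal generators $d_1<d_2<\cdots<d_m$ and $\gcd(d_1,\dots,d_m)=1$, and let $\beta_{i,j}=\beta_{i,j}(S)$ be its graded Betti numbers. Then $$\sum_{i=0}^{m-1}\sum_{j}(-1)^i\beta_{i,j}\,j^r=0\qquad\text{for every integer } r \text{ with } 0\le r\le m-2,$$ and $$\sum_{i=0}^{m-1}\sum_{j}(-1)^i\beta_{i,j}\,j^{m-1}=(-1)^{m-1}(m-1)!\prod_{i=1}^m d_i .$$ Here $0^0$ is interpreted as $1$.
   Context: $\mathbb{N}=\{0,1,2,\dots\}$. A numerical semigroup is a submonoid of $(\mathbb{N},+)$ (containing $0$); it is finitely generated, $S=\langle d_1,\dots,d_m\rangle=\{\sum_{i=1}^m a_id_i : a_i\in\mathbb{N}\}$, with the $d_i$ positive integers. The generating set is minimal if no generator is a sum (with repetitions allowed) of the other generators. The condition $\gcd(d_1,\dots,d_m)=1$ is equivalent to $\mathbb{N}\setminus S$ being finite. Let $\mathbb{K}$ be a field, and let $R=\mathbb{K}[x_1,\dots,x_m]$ be graded by $\deg x_i=d_i$. The semigroup algebra $\mathbb{K}[S]=\mathbb{K}[t^s : s\in S]\subseteq\mathbb{K}[t]$, graded by $\deg t=1$, is a graded $R$-module via $x_i\mapsto t^{d_i}$. The graded Betti number is $\beta_{i,j}(S)=\dim_{\mathbb{K}}\operatorname{Tor}_i^R(\mathbb{K}[S],\mathbb{K})_j$, i.e. the number of minimal generators of degree $j$ of the $i$-th free module in the minimal graded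 free resolution of $\mathbb{K}[S]$ over $R$. The index $j$ in the sums runs over all degrees $j\in\mathbb{N}$ (only finitely many terms are nonzero). *)

theory Defs
  imports
    "HOL-Library.Cardinality"
    "HOL-Library.Poly_Mapping"
    "HOL-Library.Function_Algebras"
    "HOL-Computational_Algebra.Polynomial"
begin

definition generated_semigroup :: "('n::finite \<Rightarrow> nat) \<Rightarrow> 'n set \<Rightarrow> nat set" where
  "generated_semigroup d I = {\<Sum>i\<in>I. a i * d i | a :: 'n \<Rightarrow> nat. True}"

definition minimal_generators :: "('n::finite \<Rightarrow> nat) \<Rightarrow> bool" where
  "minimal_generators d \<longleftrightarrow>
     (\<forall>i. 0 < d i) \<and> (\<forall>i. d i \<notin> generated_semigroup d (UNIV - {i}))"

definition semigroup_algebra :: "nat set \<Rightarrow> 'k::field poly set" where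
  "semigroup_algebra S = {g. \<forall>s. coeff g s \<noteq> 0 \<longrightarrow> s \<in> S}"

(* The polynomial ring with one variable for each element of the finite type 'n;
   an exponent vector is a finitely supported map from 'n to nat. *)
type_synonym ('n, 'k) poly_ring = "('n \<Rightarrow>\<^sub>0 nat) \<Rightarrow>\<^sub>0 'k"

definition weighted_degree :: "('n::finite \<Rightarrow> nat) \<Rightarrow> ('n \<Rightarrow>\<^sub>0 nat) \<Rightarrow> nat" where
  "weighted_degree d u = (\<Sum>i\<in>UNIV. Poly_Mapping.lookup u i * d i)"

(* The K-algebra homomorphism x_i |-> t^(d i), through which the polynomial ring
   acts on the semigroup algebra. *)
definition toric_map :: "('n::finite \<Rightarrow> nat) \<Rightarrow> ('n, 'k::field) poly_ring \<Rightarrow> 'k poly" where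
  "toric_map d p = (\<Sum>u\<in>Poly_Mapping.keys p. monom (Poly_Mapping.lookup p u) (weighted_degree d u))"

(* A list degs of degrees encodes the graded free module that is the direct sum of the
   R(-degs!k) for k < length degs: its elements are the functions nat => R vanishing from
   length degs on, and the k-th basis vector is homogeneous of degree degs!k. *)
definition free_module :: "nat list \<Rightarrow> (nat \<Rightarrow> ('n::finite, 'k::field) poly_ring) set" where
  "free_module degs = {f. \<forall>k\<ge>length degs. f k = 0}"

definition free_module_part ::
  "('n::finite \<Rightarrow> nat) \<Rightarrow> nat list \<Rightarrow> nat \<Rightarrow> (nat \<Rightarrow> ('n, 'k::field) poly_ring) set" where
  "free_module_part d degs j =
     {f \<in> free_module degs. \<forall>k<length degs. \<forall>u\<in>Poly_Mapping.keys (f k). weighted_degree d u + degs ! k = j}"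

(* The submodule P F, where P is the ideal generated by all the variables, that is, the
   ideal of the polynomials with zero constant coefficient. *)
definition irrelevant_submodule :: "nat list \<Rightarrow> (nat \<Rightarrow> ('n::finite, 'k::field) poly_ring) set" where
  "irrelevant_submodule degs = {f \<in> free_module degs. \<forall>k. Poly_Mapping.lookup (f k) 0 = 0}"

definition semigroup_algebra_part :: "nat set \<Rightarrow> nat \<Rightarrow> 'k::field poly set" where
  "semigroup_algebra_part S j = {g \<in> semigroup_algebra S. \<forall>s. coeff g s \<noteq> 0 \<longrightarrow> s = j}"

(* Degree-preserving homomorphisms of graded R-modules. A module is given by its
   carrier M, its graded pieces Mj and its scalar multiplication sM. *)
definition graded_module_hom ::
  "'a::plus set \<Rightarrow> (nat \<Rightarrow> 'a set) \<Rightarrow> ('r \<Rightarrow> 'a \<Rightarrow> 'a) \<Rightarrow>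
   'b::plus set \<Rightarrow> (nat \<Rightarrow> 'b set) \<Rightarrow> ('r \<Rightarrow> 'b \<Rightarrow> 'b) \<Rightarrow> ('a \<Rightarrow> 'b) \<Rightarrow> bool" where
  "graded_module_hom M Mj sM N Nj sN h \<longleftrightarrow>
     h ` M \<subseteq> N \<and>
     (\<forall>x\<in>M. \<forall>y\<in>M. h (x + y) = h x + h y) \<and>
     (\<forall>r. \<forall>x\<in>M. h (sM r x) = sN r (h x)) \<and>
     (\<forall>j. h ` Mj j \<subseteq> Nj j)"

definition free_scale ::
  "('n::finite, 'k::field) poly_ring \<Rightarrow> (nat \<Rightarrow> ('n, 'k) poly_ring) \<Rightarrow> nat \<Rightarrow> ('n, 'k) poly_ring"
  where "free_scale r f = (\<lambda>k. r * f k)"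

(* An exact complex  ... --> F 2 --> F 1 --> F 0 --> K[S] --> 0, with F i the graded free module
   on the degree list degs i, the differential dif i : F (i+1) --> F i and the augmentation
   aug : F 0 --> K[S], where S is generated by d. *)
definition graded_free_resolution ::
  "('n::finite \<Rightarrow> nat) \<Rightarrow> (nat \<Rightarrow> nat list) \<Rightarrow>
   ((nat \<Rightarrow> ('n, 'k::field) poly_ring) \<Rightarrow> 'k poly) \<Rightarrow>
   (nat \<Rightarrow> (nat \<Rightarrow> ('n, 'k) poly_ring) \<Rightarrow> (nat \<Rightarrow> ('n, 'k) poly_ring)) \<Rightarrow> bool" where
  "graded_free_resolution d degs aug dif \<longleftrightarrow>
     (let S = generated_semigroup d UNIV in
       graded_module_hom (free_module (degs 0)) (free_module_part d (degs 0)) free_scale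
         (semigroup_algebra S) (semigroup_algebra_part S) (\<lambda>r g. toric_map d r * g) aug \<and>
       (\<forall>i. graded_module_hom
              (free_module (degs (Suc i))) (free_module_part d (degs (Suc i))) free_scale
              (free_module (degs i)) (free_module_part d (degs i)) free_scale (dif i)) \<and>
       aug ` free_module (degs 0) = semigroup_algebra S \<and>
       dif 0 ` free_module (degs 1) = {f \<in> free_module (degs 0). aug f = 0} \<and>
       (\<forall>i. dif (Suc i) ` free_module (degs (Suc (Suc i))) =
              {f \<in> free_module (degs (Suc i)). dif i f = 0}))"

(* Minimality: every differential maps F (i+1) into P (F i). *)
definition minimal_graded_free_resolution ::
  "('n::finite \<Rightarrow> nat) \<Rightarrow> (nat \<Rightarrow> nat list) \<Rightarrow>
   ((nat \<Rightarrow> ('n, 'k::field) poly_ring) \<Rightarrow> 'k poly) \<Rightarrow>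
   (nat \<Rightarrow> (nat \<Rightarrow> ('n, 'k) poly_ring) \<Rightarrow> (nat \<Rightarrow> ('n, 'k) poly_ring)) \<Rightarrow> bool" where
  "minimal_graded_free_resolution d degs aug dif \<longleftrightarrow>
     graded_free_resolution d degs aug dif \<and>
     (\<forall>i. dif i ` free_module (degs (Suc i)) \<subseteq> irrelevant_submodule (degs i))"

(* The number of generators of degree j of F i. Minimal graded free resolutions are unique up
   to isomorphism, so for a minimal one this is the graded Betti number dim Tor_i(K[S], K)_j. *)
definition graded_betti :: "(nat \<Rightarrow> nat list) \<Rightarrow> nat \<Rightarrow> nat \<Rightarrow> nat" where
  "graded_betti degs i j = count_list (degs i) j"

lemma finite_graded_betti_support: "finite {j. graded_betti degs i j \<noteq> 0}"
  by (simp add: graded_betti_def count_list_0_iff)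

end

theory Submission
  imports Defs "HOL-Computational_Algebra.Polynomial_FPS"
begin

text \<open>
  Counting dimensions degree by degree in a finite resolution of K[S] gives
  $K(t) = \sum_{i,j} (-1)^i \beta_{i,j} t^j = H_S(t) \prod_i (1 - t^{d_i})$. Since
  $H_S(t) = 1/(1-t) - G(t)$ for the polynomial $G$ of the gaps, $K(t) = (1-t)^{m-1} Q(t)$ with
  $Q(1) = \prod_i d_i$, and applying the operator $t\,\frac{d}{dt}$ repeatedly at $t = 1$ gives the
  moments. That a minimal resolution stops before degree $m$ is seen by killing the variables one
  at a time: the first one is regular on K[S], every further one costs at most one degree of
  exactness, and after all $m$ of them the differentials of a minimal resolution vanish.
\<close>

subsection \<open>The Euler operator\<close>

text \<open>Over \<open>m\<close> variables a minimal resolution may in general have length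
  \<open>m\<close>, but the sums stop at \<open>m - 1\<close>. The degree saved is the positive
  depth of K[S]: it lies in the domain K[t], and a variable acts on it as a positive power of t.
  Modulo one variable the quotient may have depth 0, so for the others only a loss of one degree of
  exactness can be claimed; it is what the long exact sequence of multiplication by a variable
  gives, carried out here by chasing elements.

  The power \<open>m - 1\<close> of 1-t arises because each of the \<open>m\<close> factors
  1-t^(d_i) has a simple zero at 1, while H_S has a simple pole. There (1-t) H_S takes the value 1
  and (1-t^(d_i))/(1-t) the value d_i, whence Q(1). Each Euler step lowers the order of the zero at
  1 by one and multiplies by minus that order, whence the sign and the factorial.

  Exactness is given for whole modules, but dimensions can be counted only in a single degree, where
  positive weights make the pieces finite-dimensional. Homogeneous preimages are therefore
  needed.\<close>

definition euler_op :: "'a::idom poly \<Rightarrow> 'a poly" where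
  "euler_op p = pCons 0 (pderiv p)"

lemma euler_op_funpow_add: "(euler_op ^^ r) (p + q) = (euler_op ^^ r) p + (euler_op ^^ r) q"
  by (induction r) (auto simp: euler_op_def pderiv_add)

lemma euler_op_funpow_0 [simp]: "(euler_op ^^ r) 0 = 0"
  by (induction r) (auto simp: euler_op_def)

lemma euler_op_funpow_sum: "(euler_op ^^ r) (sum f A) = (\<Sum>x\<in>A. (euler_op ^^ r) (f x))"
  by (induction A rule: infinite_finite_induct) (auto simp: euler_op_funpow_add)

lemma euler_op_monom: "euler_op (monom c j) = monom (of_nat j * c) j"
  by (cases j) (simp_all add: euler_op_def pderiv_monom flip: monom_Suc)

lemma euler_op_funpow_monom: "(euler_op ^^ r) (monom c j) = monom (of_nat j ^ r * c) j"
  by (induction r) (auto simp: euler_op_monom mult.assoc)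

text \<open>By the Leibniz rule one factor 1-t is used up, and the new cofactor has the value -(n+1)
  q(1) at 1.\<close>

lemma euler_op_mult_power:
  fixes q :: "'a::{idom,ring_char_0} poly"
  shows "euler_op ([:1, -1:] ^ Suc n * q) =
     [:1, -1:] ^ n * ([:1, -1:] * euler_op q - smult (of_nat (Suc n)) (pCons 0 q))"
proof -
  define p :: "'a poly" where "p = [:1, -1:]"
  have dp: "pderiv p = - 1" by (simp add: p_def pderiv_pCons one_pCons)
  have "pderiv (p ^ Suc n * q) = p ^ n * (p * pderiv q - smult (of_nat (Suc n)) q)"
    unfolding pderiv_mult pderiv_power_Suc dp
    by (simp add: algebra_simps smult_add_left)
  moreover define x :: "'a poly" where "x = [:0, 1:]"
  moreover have X: "pCons 0 r = x * r" for r by (simp add: x_def)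
  ultimately have "pCons 0 (pderiv (p ^ Suc n * q)) =
      p ^ n * (p * (x * pderiv q) - smult (of_nat (Suc n)) (x * q))"
    by (simp only: X right_diff_distrib mult.left_commute mult_smult_right)
  then show ?thesis unfolding p_def euler_op_def X .
qed

lemma poly_euler_op_funpow_at_1:
  fixes q :: "'a::{idom,ring_char_0} poly"
  assumes "r \<le> n"
  shows "poly ((euler_op ^^ r) ([:1, -1:] ^ n * q)) 1 =
    (if r < n then 0 else (-1) ^ n * fact n * poly q 1)"
  using assms
proof (induction r arbitrary: n q)
  case 0
  then show ?case by (cases n) auto
next
  case (Suc r)
  then obtain n' where n: "n = Suc n'" by (cases n) auto
  show ?case
    \<comment> \<open>The innermost application is peeled off, so the induction runs on the cofactor
      it leaves; this is why \<open>n\<close> and \<open>q\<close> vary.\<close>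
    using Suc.IH[of n' "[:1, -1:] * euler_op q - smult (of_nat (Suc n')) (pCons 0 q)"] Suc.prems
    unfolding funpow_Suc_right o_apply n euler_op_mult_power
    by (auto simp: algebra_simps)
qed

subsection \<open>Numerical semigroups and Hilbert series\<close>

lemma bezout_family:
  fixes d :: "'a \<Rightarrow> nat"
  assumes "finite A"
  shows "\<exists>c::'a \<Rightarrow> int. (\<Sum>i\<in>A. c i * int (d i)) = int (Gcd (d ` A))"
  using assms
proof induction
  case empty
  then show ?case by simp
next
  case (insert x A)
  then obtain c where c: "(\<Sum>i\<in>A. c i * int (d i)) = int (Gcd (d ` A))" by blast
  obtain u v where uv: "u * int (d x) + v * int (Gcd (d ` A)) = gcd (int (d x)) (int (Gcd (d ` A)))"
    using bezout_int by blast
  have "(\<Sum>i\<in>insert x A. (if i = x then u else v * c i) * int (d i)) =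
      u * int (d x) + (\<Sum>i\<in>A. v * c i * int (d i))"
    using insert.hyps by (auto intro!: sum.cong)
  also have "(\<Sum>i\<in>A. v * c i * int (d i)) = v * int (Gcd (d ` A))"
    by (simp add: c[symmetric] sum_distrib_left mult.assoc)
  finally show ?case using uv by (intro exI) (auto simp: gcd_int_int_eq)
qed

lemma generated_semigroup_0: "0 \<in> generated_semigroup d I"
  unfolding generated_semigroup_def by (auto intro!: exI[of _ "\<lambda>_. 0"])

lemma generated_semigroup_add:
  assumes "x \<in> generated_semigroup d I" "y \<in> generated_semigroup d I"
  shows "x + y \<in> generated_semigroup d I"
proof -
  obtain a b where "x = (\<Sum>i\<in>I. a i * d i)" "y = (\<Sum>i\<in>I. b i * d i)"
    using assms unfolding generated_semigroup_def by blast
  then have "x + y = (\<Sum>i\<in>I. (a i + b i) * d i)" by (simp add: sum.distrib algebra_simps)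
  then show ?thesis unfolding generated_semigroup_def by (intro CollectI exI) auto
qed

lemma generated_semigroup_mult:
  assumes "x \<in> generated_semigroup d I"
  shows "n * x \<in> generated_semigroup d I"
  using assms by (induction n) (auto intro: generated_semigroup_0 generated_semigroup_add)

text \<open>Moving the negative terms of a Bezout relation to the other side exhibits two
  consecutive elements \<open>a\<close> and \<open>a + 1\<close> of the semigroup, and these
  generate every large integer.\<close>

lemma generated_semigroup_cofinite:
  fixes d :: "'n::finite \<Rightarrow> nat"
  assumes "Gcd (range d) = 1"
  obtains N where "\<And>n. N \<le> n \<Longrightarrow> n \<in> generated_semigroup d UNIV"
proof -
  let ?S = "generated_semigroup d UNIV"
  obtain c :: "'n \<Rightarrow> int" where c: "(\<Sum>i\<in>UNIV. c i * int (d i)) = 1"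
    using bezout_family[of UNIV d] assms by auto
  \<comment> \<open>\<open>nat\<close> sends negative integers to 0, so only the indices with a
    negative Bezout coefficient contribute.\<close>
  define a where "a = (\<Sum>i\<in>UNIV. nat (- c i) * d i)"
  have "int (\<Sum>i\<in>UNIV. nat (c i) * d i) = (\<Sum>i\<in>UNIV. c i * int (d i)) + int a"
    unfolding a_def of_nat_sum sum.distrib[symmetric]
  proof (rule sum.cong)
    fix i
    have "int (nat (c i)) = c i + int (nat (- c i))" by simp
    then show "int (nat (c i) * d i) = c i * int (d i) + int (nat (- c i) * d i)"
      by (simp only: of_nat_mult distrib_right)
  qed simp
  then have "int (\<Sum>i\<in>UNIV. nat (c i) * d i) = int (a + 1)" unfolding c by simp
  then have "a + 1 = (\<Sum>i\<in>UNIV. nat (c i) * d i)" by linarith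
  then have a1: "a + 1 \<in> ?S"
    unfolding generated_semigroup_def by (intro CollectI exI) auto
  have a0: "a \<in> ?S" unfolding generated_semigroup_def a_def by (intro CollectI exI) auto
  show thesis
  \<comment> \<open>From \<open>a * a\<close> on, the quotient \<open>n div a\<close> exceeds the
    remainder \<open>n mod a\<close>, so that many copies of \<open>a\<close> can be turned into
    \<open>a + 1\<close> to absorb the remainder.\<close>
  proof (rule that[of "a * a"])
    fix n assume n: "a * a \<le> n"
    show "n \<in> ?S"
    proof (cases "a = 0")
      case True
      then show ?thesis using generated_semigroup_mult[OF a1, of n] by simp
    next
      case False
      have "a \<le> n div a" using n False by (simp add: less_eq_div_iff_mult_less_eq)
      moreover have "n mod a < a" using False by simp
      ultimately obtain k where k: "n div a = n mod a + k"
        by (metis le_iff_add less_imp_le order_trans)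
      have "n = n div a * a + n mod a" by simp
      also have "\<dots> = k * a + (n mod a) * (a + 1)" unfolding k by (simp add: algebra_simps)
      finally show ?thesis
        using generated_semigroup_add[OF generated_semigroup_mult[OF a0] generated_semigroup_mult[OF a1]]
        by metis
    qed
  qed
qed

section \<open>Counting monomials by weighted degree\<close>

definition monomials_of_degree ::
  "('n::finite \<Rightarrow> nat) \<Rightarrow> 'n set \<Rightarrow> nat \<Rightarrow> ('n \<Rightarrow>\<^sub>0 nat) set" where
  "monomials_of_degree d A n = {u. Poly_Mapping.keys u \<subseteq> A \<and> weighted_degree d u = n}"

lemma weighted_degree_add: "weighted_degree d (u + v) = weighted_degree d u + weighted_degree d v"
  by (simp add: weighted_degree_def lookup_add sum.distrib algebra_simps)

lemma weighted_degree_single: "weighted_degree d (Poly_Mapping.single i k) = k * d i"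
  by (simp add: weighted_degree_def lookup_single when_def if_distrib[of "\<lambda>x. x * _"] cong: if_cong)

lemma weighted_degree_0 [simp]: "weighted_degree d 0 = 0"
  by (simp add: weighted_degree_def)

lemma finite_monomials_of_degree:
  assumes "\<And>i. 0 < d i"
  shows "finite (monomials_of_degree d A n)"
proof (rule finite_imageD)
  show "inj_on Poly_Mapping.lookup (monomials_of_degree d A n)"
    by (auto simp: inj_on_def Poly_Mapping.lookup_inject)
  have "Poly_Mapping.lookup u i \<le> n" if "u \<in> monomials_of_degree d A n" for u i
  proof -
    have "Poly_Mapping.lookup u i \<le> Poly_Mapping.lookup u i * d i" using assms[of i] by simp
    also have "\<dots> \<le> weighted_degree d u"
      unfolding weighted_degree_def by (rule member_le_sum) auto
    finally show ?thesis using that by (simp add: monomials_of_degree_def)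
  qed
  then have "Poly_Mapping.lookup ` monomials_of_degree d A n
      \<subseteq> {f. \<forall>x. (x \<in> UNIV \<longrightarrow> f x \<in> {..n}) \<and> (x \<notin> UNIV \<longrightarrow> f x = 0)}"
    by auto
  then show "finite (Poly_Mapping.lookup ` monomials_of_degree d A n)"
    by (rule finite_subset) (rule finite_set_of_finite_funs, auto)
qed

lemma split_off_variable:
  assumes "Poly_Mapping.lookup u i \<noteq> (0::nat)"
  shows "u = Poly_Mapping.single i 1 + (u - Poly_Mapping.single i 1)"
  using assms
  by (intro poly_mapping_eqI) (auto simp: lookup_add lookup_minus lookup_single when_def)

text \<open>A monomial either avoids \<open>x\<close> or is \<open>x\<close> times a monomial of
  degree smaller by \<open>d x\<close>. On generating functions this recursion is multiplication by
  1-t^(d x), which is why the counts carry a set \<open>A\<close> of allowed variables.\<close>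

lemma card_monomials_of_degree_insert:
  assumes pos: "\<And>i. 0 < d i" and x: "x \<notin> A"
  shows "card (monomials_of_degree d (insert x A) n) = card (monomials_of_degree d A n) +
    (if n < d x then 0 else card (monomials_of_degree d (insert x A) (n - d x)))"
proof -
  let ?M = "monomials_of_degree d" and ?e = "Poly_Mapping.single x (1::nat)"
  let ?T = "if n < d x then {} else (\<lambda>u. ?e + u) ` ?M (insert x A) (n - d x)"
  have "?M (insert x A) n \<subseteq> ?M A n \<union> ?T"
  proof
    fix u assume u: "u \<in> ?M (insert x A) n"
    show "u \<in> ?M A n \<union> ?T"
    proof (cases "Poly_Mapping.lookup u x = 0")
      case True
      then show ?thesis using u by (auto simp: monomials_of_degree_def in_keys_iff)
    next
      case False
      note e = split_off_variable[OF False]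
      then have "n = d x + weighted_degree d (u - ?e)"
        using u by (metis (mono_tags) monomials_of_degree_def mem_Collect_eq weighted_degree_add
          weighted_degree_single mult_1)
      moreover have "Poly_Mapping.keys (u - ?e) \<subseteq> insert x A"
      proof -
        have "Poly_Mapping.keys (u - ?e) \<subseteq> Poly_Mapping.keys u"
          by (auto simp: in_keys_iff lookup_minus)
        then show ?thesis using u by (auto simp: monomials_of_degree_def)
      qed
      ultimately show ?thesis using e by (auto simp: monomials_of_degree_def)
    qed
  qed
  moreover have "?T \<subseteq> ?M (insert x A) n"
    using keys_add[of ?e]
    by (fastforce simp: monomials_of_degree_def weighted_degree_add weighted_degree_single split: if_splits)
  moreover have "?M A n \<subseteq> ?M (insert x A) n" by (auto simp: monomials_of_degree_def)
  ultimately have eq: "?M (insert x A) n = ?M A n \<union> ?T" by blast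
  have disj: "?M A n \<inter> ?T = {}"
    using x by (auto simp: monomials_of_degree_def in_keys_iff lookup_add subset_iff)
  have "card (?M (insert x A) n) = card (?M A n) + card ?T"
    unfolding eq using finite_monomials_of_degree[of d, OF pos] disj
    by (intro card_Un_disjoint) auto
  then show ?thesis by (auto simp: card_image)
qed

lemma monomials_of_degree_empty: "monomials_of_degree d {} n = (if n = 0 then {0} else {})"
  by (auto simp: monomials_of_degree_def)

lemma hilbert_series_polynomial_ring:
  fixes d :: "'n::finite \<Rightarrow> nat"
  assumes pos: "\<And>i. 0 < d i"
  shows "Abs_fps (\<lambda>n. int (card (monomials_of_degree d A n))) * (\<Prod>i\<in>A. 1 - fps_X ^ d i) = 1"
proof -
  have "finite A" by simp
  then show ?thesis
  proof induction
    case empty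
    then show ?case by (auto simp: monomials_of_degree_empty fps_eq_iff)
  next
    case (insert x A)
    let ?H = "\<lambda>A. Abs_fps (\<lambda>n. int (card (monomials_of_degree d A n)))"
    have "?H (insert x A) * (1 - fps_X ^ d x) = ?H A"
      by (rule fps_ext) (auto simp: right_diff_distrib fps_X_power_mult_right_nth
        card_monomials_of_degree_insert[of d, OF pos insert.hyps(2)])
    with insert show ?case by (simp add: mult.assoc[symmetric])
  qed
qed

lemma one_minus_power_poly: "1 - [:0, 1:] ^ k = [:1, -1:] * (\<Sum>l<k. monom (1::'a::comm_ring_1) l)"
proof -
  have "[:1, -1:] * (\<Sum>l<k. monom (1::'a) l) = (1 - [:0, 1:]) * (\<Sum>l<k. [:0, 1:] ^ l)"
    by (simp add: monom_altdef one_pCons)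
  then show ?thesis by (simp add: one_diff_power_eq)
qed

text \<open>H_S is not a polynomial, but (1-t) H_S is. After multiplying by 1-t the identity can be
  moved from power series to polynomials, where the extra factor is cancelled again;
  \<open>m\<close> factors 1-t then become \<open>m - 1\<close>.\<close>

lemma numerator_factorization:
  fixes d :: "'n::finite \<Rightarrow> nat" and K :: "int poly"
  assumes pos: "\<And>i. 0 < d i"
    and cofinite: "\<And>n. N \<le> n \<Longrightarrow> n \<in> S"
    and hilb: "fps_of_poly K * Abs_fps (\<lambda>n. int (card (monomials_of_degree d UNIV n))) =
      Abs_fps (\<lambda>n. if n \<in> S then 1 else 0)"
  obtains Q where "K = [:1, -1:] ^ (CARD('n) - 1) * Q" "poly Q 1 = (\<Prod>i\<in>UNIV. int (d i))"
proof -
  let ?P = "\<Prod>i\<in>UNIV. 1 - [:0, 1:] ^ d i :: int poly"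
  let ?q = "\<lambda>i. \<Sum>l<d i. monom (1::int) l"
  \<comment> \<open>The gap polynomial: by \<open>cofinite\<close> every gap lies below
    \<open>N\<close>.\<close>
  define G where "G = (\<Sum>n\<in>{..<N} - S. monom (1::int) n)"
  let ?HS = "Abs_fps (\<lambda>n. if n \<in> S then 1 else 0 :: int)"
  have P: "fps_of_poly ?P = (\<Prod>i\<in>UNIV. 1 - fps_X ^ d i)"
    by (simp add: fps_of_poly_prod fps_of_poly_diff fps_of_poly_power fps_of_poly_fps_X)
  have K: "fps_of_poly K = ?HS * fps_of_poly ?P"
    unfolding hilb[symmetric] P mult.assoc hilbert_series_polynomial_ring[of d, OF pos] by simp
  have cG: "coeff G n = (if n \<in> S then 0 else 1)" for n
    using cofinite[of n] unfolding G_def coeff_sum coeff_monom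
    by (subst sum.delta) (auto simp: not_le)
  have "?HS + fps_of_poly G = Abs_fps (\<lambda>_. 1)"
    by (rule fps_ext) (auto simp: cG)
  moreover have "(1 - fps_X) * Abs_fps (\<lambda>_. 1::int) = 1"
    by (rule fps_ext) (auto simp: left_diff_distrib)
  ultimately have "(1 - fps_X) * (?HS + fps_of_poly G) = 1" by simp
  then have HS: "(1 - fps_X) * ?HS = 1 - (1 - fps_X) * fps_of_poly G"
    by (simp add: algebra_simps)
  have X: "fps_of_poly [:1, -1:] = (1 - fps_X :: int fps)"
    by (simp add: fps_of_poly_pCons)
  have "fps_of_poly ([:1, -1:] * K) = fps_of_poly ((1 - [:1, -1:] * G) * ?P)"
    unfolding fps_of_poly_mult fps_of_poly_diff X K fps_of_poly_1
    by (simp only: HS[symmetric] mult.assoc)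
  then have "[:1, -1:] * K = (1 - [:1, -1:] * G) * ?P"
    by (simp only: fps_of_poly_eq_iff)
  also have "?P = [:1, -1:] ^ CARD('n) * (\<Prod>i\<in>UNIV. ?q i)"
    unfolding one_minus_power_poly prod.distrib by simp
  also have "[:1, -1:] ^ CARD('n) = [:1, -1:] * [:1, -1:] ^ (CARD('n) - 1)"
    by (metis power_minus_mult zero_less_card_finite mult.commute)
  finally have "[:1, -1:] * K = [:1, -1:] *
      ([:1, -1:] ^ (CARD('n) - 1) * ((1 - [:1, -1:] * G) * (\<Prod>i\<in>UNIV. ?q i)))"
    by (simp only: mult_ac)
  then have "K = [:1, -1:] ^ (CARD('n) - 1) * ((1 - [:1, -1:] * G) * (\<Prod>i\<in>UNIV. ?q i))"
    by (subst (asm) mult_left_cancel) simp_all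
  \<comment> \<open>At 1 the term with \<open>G\<close> vanishes, and the geometric sum
    \<open>?q i\<close> counts its \<open>d i\<close> summands.\<close>
  moreover have "poly ((1 - [:1, -1:] * G) * (\<Prod>i\<in>UNIV. ?q i)) 1 = (\<Prod>i\<in>UNIV. int (d i))"
    by (simp add: poly_prod poly_sum poly_monom)
  ultimately show thesis by (rule that)
qed

subsection \<open>Submodules generated by variables\<close>

lemma poly_mapping_as_sum:
  "p = (\<Sum>u\<in>Poly_Mapping.keys p. Poly_Mapping.single u (Poly_Mapping.lookup p u))"
  by (rule poly_mapping_eqI) (auto simp: lookup_sum lookup_single when_def in_keys_iff)

text \<open>Cancellation in the exponent monoid leaves \<open>u\<close> as the only exponent of
  \<open>p\<close> that \<open>v\<close> can shift to \<open>v + u\<close>.\<close>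

lemma lookup_single_mult:
  fixes p :: "'a::cancel_comm_monoid_add \<Rightarrow>\<^sub>0 'k::semiring_0"
  shows "Poly_Mapping.lookup (Poly_Mapping.single v c * p) (v + u) = c * Poly_Mapping.lookup p u"
proof -
  have "Poly_Mapping.single v c * p =
      (\<Sum>w\<in>Poly_Mapping.keys p. Poly_Mapping.single (v + w) (c * Poly_Mapping.lookup p w))"
    by (subst poly_mapping_as_sum[of p]) (simp add: sum_distrib_left mult_single)
  then show ?thesis
    by (auto simp: lookup_sum lookup_single when_def in_keys_iff)
qed

lemma lookup_single_0_mult [simp]:
  fixes p :: "'a::cancel_comm_monoid_add \<Rightarrow>\<^sub>0 'k::semiring_0"
  shows "Poly_Mapping.lookup (Poly_Mapping.single 0 c * p) u = c * Poly_Mapping.lookup p u"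
  using lookup_single_mult[of 0 c p u] by simp

lemma sum_fun_apply: "(\<Sum>a\<in>A. f a) x = (\<Sum>a\<in>A. f a x)"
  by (induction A rule: infinite_finite_induct) auto

definition "ring_var i = Poly_Mapping.single (Poly_Mapping.single i (1::nat)) 1"

text \<open>With \<open>var_quot\<close>, division by a variable with remainder. Working monomial by
  monomial introduces no new exponents in the remainder, so it stays inside a monomial ideal
  generated by other variables.\<close>

definition var_rest ::
  "'n::finite \<Rightarrow> ('n, 'k::field) poly_ring \<Rightarrow> ('n, 'k) poly_ring" where
  "var_rest i p = (\<Sum>u\<in>{u\<in>Poly_Mapping.keys p. Poly_Mapping.lookup u i = 0}.
     Poly_Mapping.single u (Poly_Mapping.lookup p u))"

definition var_quot ::
  "'n::finite \<Rightarrow> ('n, 'k::field) poly_ring \<Rightarrow> ('n, 'k) poly_ring" where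
  "var_quot i p = (\<Sum>u\<in>{u\<in>Poly_Mapping.keys p. Poly_Mapping.lookup u i \<noteq> 0}.
     Poly_Mapping.single (u - Poly_Mapping.single i 1) (Poly_Mapping.lookup p u))"

lemma var_rest_0 [simp]: "var_rest i 0 = 0" and var_quot_0 [simp]: "var_quot i 0 = 0"
  by (simp_all add: var_rest_def var_quot_def)

lemma var_rest_plus_quot: "var_rest i p + ring_var i * var_quot i p = p"
proof -
  have "ring_var i * var_quot i p = (\<Sum>u\<in>{u\<in>Poly_Mapping.keys p. Poly_Mapping.lookup u i \<noteq> 0}.
      Poly_Mapping.single u (Poly_Mapping.lookup p u))"
    unfolding var_quot_def ring_var_def sum_distrib_left mult_single
    by (rule sum.cong) (simp_all add: split_off_variable[symmetric] flip: One_nat_def)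
  moreover have "var_rest i p + \<dots> =
      (\<Sum>u\<in>Poly_Mapping.keys p. Poly_Mapping.single u (Poly_Mapping.lookup p u))"
    unfolding var_rest_def
    by (subst sum.union_disjoint[symmetric]) (auto intro: sum.cong)
  ultimately show ?thesis using poly_mapping_as_sum[of p] by simp
qed

lemma keys_var_rest: "Poly_Mapping.keys (var_rest i p) \<subseteq> {u \<in> Poly_Mapping.keys p. Poly_Mapping.lookup u i = 0}"
  unfolding var_rest_def by (rule order_trans[OF keys_sum]) auto

lemma free_module_0 [simp]: "0 \<in> free_module D"
  by (simp add: free_module_def)

lemma free_module_add: "f \<in> free_module D \<Longrightarrow> g \<in> free_module D \<Longrightarrow> f + g \<in> free_module D"
  by (simp add: free_module_def)

lemma free_module_diff: "f \<in> free_module D \<Longrightarrow> g \<in> free_module D \<Longrightarrow> f - g \<in> free_module D"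
  by (simp add: free_module_def)

lemma free_module_scale: "f \<in> free_module D \<Longrightarrow> free_scale r f \<in> free_module D"
  by (simp add: free_module_def free_scale_def)

lemma free_scale_minus_1: "free_scale (-1) f = - f"
  by (auto simp: free_scale_def)

(* I_A F for the ideal I_A generated by the variables in A *)
definition variable_submodule ::
  "'n::finite set \<Rightarrow> nat list \<Rightarrow> (nat \<Rightarrow> ('n, 'k::field) poly_ring) set" where
  "variable_submodule A D =
     {f \<in> free_module D. \<forall>k. \<forall>u\<in>Poly_Mapping.keys (f k). \<exists>i\<in>A. Poly_Mapping.lookup u i \<noteq> 0}"

lemma variable_submodule_subset: "f \<in> variable_submodule A D \<Longrightarrow> f \<in> free_module D"
  by (simp add: variable_submodule_def)

lemma variable_submodule_mono: "A \<subseteq> B \<Longrightarrow> variable_submodule A D \<subseteq> variable_submodule B D"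
  by (fastforce simp: variable_submodule_def)

lemma variable_submodule_empty: "variable_submodule {} D = {0}"
  by (auto simp: variable_submodule_def free_module_def)

lemma variable_submodule_UNIV:
  "variable_submodule UNIV D = (irrelevant_submodule D :: (nat \<Rightarrow> ('n::finite, 'k::field) poly_ring) set)"
proof -
  have "(\<forall>u\<in>Poly_Mapping.keys p. \<exists>i. Poly_Mapping.lookup u i \<noteq> 0) \<longleftrightarrow> Poly_Mapping.lookup p 0 = 0"
    for p :: "('n, 'k) poly_ring"
  proof -
    have "(\<exists>i. Poly_Mapping.lookup u i \<noteq> 0) \<longleftrightarrow> u \<noteq> 0" for u :: "'n \<Rightarrow>\<^sub>0 nat"
      by (auto intro: poly_mapping_eqI)
    then show ?thesis by (auto simp: in_keys_iff)
  qed
  then show ?thesis by (simp add: variable_submodule_def irrelevant_submodule_def)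
qed

lemma variable_submodule_add:
  assumes "f \<in> variable_submodule A D" "g \<in> variable_submodule A D"
  shows "f + g \<in> variable_submodule A D"
proof -
  have "Poly_Mapping.keys ((f + g) k) \<subseteq> Poly_Mapping.keys (f k) \<union> Poly_Mapping.keys (g k)" for k
    using keys_add[of "f k" "g k"] by simp
  then show ?thesis using assms by (fastforce simp: variable_submodule_def free_module_add)
qed

lemma variable_submodule_scale:
  assumes "f \<in> variable_submodule A D"
  shows "free_scale r f \<in> variable_submodule A D"
proof -
  have "\<exists>i\<in>A. Poly_Mapping.lookup u i \<noteq> 0" if u: "u \<in> Poly_Mapping.keys (r * f k)" for k u
  proof -
    obtain a b where "u = a + b" "b \<in> Poly_Mapping.keys (f k)"
      using keys_mult[of r "f k"] u by blast
    moreover obtain i where "i \<in> A" "Poly_Mapping.lookup b i \<noteq> 0"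
      using assms \<open>b \<in> Poly_Mapping.keys (f k)\<close> by (force simp: variable_submodule_def)
    ultimately show ?thesis by (auto simp: lookup_add)
  qed
  then show ?thesis
    using assms by (auto simp: variable_submodule_def free_module_scale) (auto simp: free_scale_def)
qed

lemma variable_submodule_uminus:
  assumes "f \<in> variable_submodule A D"
  shows "- f \<in> variable_submodule A D"
  using variable_submodule_scale[OF assms, of "-1"] by (simp add: free_scale_minus_1)

lemma variable_submodule_var:
  assumes "f \<in> free_module D" "x \<in> A"
  shows "free_scale (ring_var x) f \<in> variable_submodule A D"
proof -
  have "Poly_Mapping.lookup u x \<noteq> 0" if u: "u \<in> Poly_Mapping.keys (ring_var x * f k)" for k u
  proof -
    obtain b where "u = Poly_Mapping.single x 1 + b"
      using keys_mult[of "ring_var x" "f k"] u by (auto simp: ring_var_def)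
    then show ?thesis by (simp add: lookup_add)
  qed
  then show ?thesis
    using assms by (auto simp: variable_submodule_def free_module_scale) (auto simp: free_scale_def)
qed

text \<open>A variable outside \<open>A\<close> is a nonzerodivisor modulo the ideal of the
  variables in \<open>A\<close>: multiplying by it changes no exponent at an index in
  \<open>A\<close>.\<close>

lemma variable_submodule_cancel_var:
  assumes "free_scale (ring_var x) f \<in> variable_submodule A D" "x \<notin> A" "f \<in> free_module D"
  shows "f \<in> variable_submodule A D"
proof -
  have "\<exists>i\<in>A. Poly_Mapping.lookup u i \<noteq> 0" if u: "u \<in> Poly_Mapping.keys (f k)" for k u
  proof -
    have "Poly_Mapping.single x 1 + u \<in> Poly_Mapping.keys (ring_var x * f k)"
      using u unfolding in_keys_iff ring_var_def lookup_single_mult by simp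
    then obtain i where i: "i \<in> A" "Poly_Mapping.lookup (Poly_Mapping.single x 1 + u) i \<noteq> 0"
      using assms(1) by (force simp: variable_submodule_def free_scale_def)
    with assms(2) show ?thesis
      by (intro bexI[of _ i]) (auto simp: lookup_add lookup_single when_def split: if_splits)
  qed
  then show ?thesis using assms(3) by (simp add: variable_submodule_def)
qed

lemma variable_submodule_insertE:
  assumes "f \<in> variable_submodule (insert x A) D"
  obtains a b where "a \<in> variable_submodule A D" "b \<in> free_module D"
    "f = a + free_scale (ring_var x) b"
proof
  show "(\<lambda>k. var_rest x (f k)) \<in> variable_submodule A D"
    using assms keys_var_rest[of x] by (fastforce simp: variable_submodule_def free_module_def)
  show "(\<lambda>k. var_quot x (f k)) \<in> free_module D"
    using assms by (simp add: variable_submodule_def free_module_def)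
  show "f = (\<lambda>k. var_rest x (f k)) + free_scale (ring_var x) (\<lambda>k. var_quot x (f k))"
    by (simp add: fun_eq_iff free_scale_def var_rest_plus_quot)
qed

lemma toric_map_single: "toric_map d (Poly_Mapping.single u c) = monom c (weighted_degree d u)"
  by (simp add: toric_map_def)

subsection \<open>Length of the minimal resolution\<close>

locale toric_resolution =
  fixes d :: "'n::finite \<Rightarrow> nat"
    and degs :: "nat \<Rightarrow> nat list"
    and aug :: "(nat \<Rightarrow> ('n, 'k::field) poly_ring) \<Rightarrow> 'k poly"
    and dif :: "nat \<Rightarrow> (nat \<Rightarrow> ('n, 'k) poly_ring) \<Rightarrow> (nat \<Rightarrow> ('n, 'k) poly_ring)"
  assumes resolution: "graded_free_resolution d degs aug dif"
begin

abbreviation "S \<equiv> generated_semigroup d UNIV"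
abbreviation "F i \<equiv> free_module (degs i)"
abbreviation "Fpart i j \<equiv> free_module_part d (degs i) j"

lemma aug_hom: "graded_module_hom (F 0) (Fpart 0) free_scale
    (semigroup_algebra S) (semigroup_algebra_part S) (\<lambda>r g. toric_map d r * g) aug"
  and dif_hom: "graded_module_hom (F (Suc i)) (Fpart (Suc i)) free_scale (F i) (Fpart i) free_scale (dif i)"
  and aug_surj: "aug ` F 0 = semigroup_algebra S"
  and exact_0: "dif 0 ` F 1 = {f \<in> F 0. aug f = 0}"
  and exact_Suc: "dif (Suc i) ` F (Suc (Suc i)) = {f \<in> F (Suc i). dif i f = 0}"
  using resolution by (simp_all add: graded_free_resolution_def Let_def)

lemma aug_add: "f \<in> F 0 \<Longrightarrow> g \<in> F 0 \<Longrightarrow> aug (f + g) = aug f + aug g"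
  and aug_scale: "f \<in> F 0 \<Longrightarrow> aug (free_scale r f) = toric_map d r * aug f"
  and aug_part: "f \<in> Fpart 0 j \<Longrightarrow> aug f \<in> semigroup_algebra_part S j"
  using aug_hom unfolding graded_module_hom_def by (simp_all add: image_subset_iff)

lemma dif_in: "f \<in> F (Suc i) \<Longrightarrow> dif i f \<in> F i"
  and dif_add: "f \<in> F (Suc i) \<Longrightarrow> g \<in> F (Suc i) \<Longrightarrow> dif i (f + g) = dif i f + dif i g"
  and dif_scale: "f \<in> F (Suc i) \<Longrightarrow> dif i (free_scale r f) = free_scale r (dif i f)"
  and dif_part: "f \<in> Fpart (Suc i) j \<Longrightarrow> dif i f \<in> Fpart i j"
  using dif_hom[of i] unfolding graded_module_hom_def by (simp_all add: image_subset_iff)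

lemma aug_dif: "f \<in> F 1 \<Longrightarrow> aug (dif 0 f) = 0"
  using exact_0 by blast

lemma dif_dif: "f \<in> F (Suc (Suc i)) \<Longrightarrow> dif i (dif (Suc i) f) = 0"
  using exact_Suc by blast

lemma dif_0: "dif i 0 = 0"
proof -
  have "dif i (free_scale 0 0) = free_scale 0 (dif i 0)" by (rule dif_scale) simp
  then show ?thesis by (simp add: free_scale_def zero_fun_def)
qed

lemma dif_uminus: "f \<in> F (Suc i) \<Longrightarrow> dif i (- f) = - dif i f"
  using dif_scale[of f i "-1"] by (simp add: free_scale_minus_1)

lemma dif_diff: "f \<in> F (Suc i) \<Longrightarrow> g \<in> F (Suc i) \<Longrightarrow> dif i (f - g) = dif i f - dif i g"
  using dif_add[of f i "- g"] dif_uminus[of g i] free_module_diff[of 0 "degs (Suc i)" g] by simp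

text \<open>Immediate from linearity for a submodule given by generators; since membership is
  defined through exponents, the variables are split off one at a time.\<close>

lemma dif_variable_submodule:
  assumes "f \<in> variable_submodule A (degs (Suc i))"
  shows "dif i f \<in> variable_submodule A (degs i)"
proof -
  have "finite A" by simp
  then show ?thesis using assms
  proof (induction A arbitrary: f)
    case empty
    then show ?case by (simp only: variable_submodule_empty dif_0 singleton_iff)
  next
    case (insert x A)
    obtain a b where ab: "a \<in> variable_submodule A (degs (Suc i))" "b \<in> F (Suc i)"
      and f: "f = a + free_scale (ring_var x) b"
      using variable_submodule_insertE[OF insert.prems] .
    have "dif i f = dif i a + free_scale (ring_var x) (dif i b)"
      unfolding f using ab by (simp add: dif_add dif_scale free_module_scale variable_submodule_subset)
    moreover have "dif i a \<in> variable_submodule (insert x A) (degs i)"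
      using insert.IH[OF ab(1)] variable_submodule_mono[of A "insert x A"] by blast
    moreover have "free_scale (ring_var x) (dif i b) \<in> variable_submodule (insert x A) (degs i)"
      using ab by (simp add: variable_submodule_var dif_in)
    ultimately show ?case by (metis variable_submodule_add)
  qed
qed

(* The complex reduced modulo the variables in A is exact from homological degree card A on:
   multiplication by a variable outside A is injective on the reduced complex, and each variable
   costs one degree of exactness, except for the first one, which is regular on K[S]. *)
lemma exact_modulo_variables:
  assumes "card A \<le> Suc i" "f \<in> F (Suc i)" "dif i f \<in> variable_submodule A (degs i)"
  obtains g where "g \<in> F (Suc (Suc i))" "f - dif (Suc i) g \<in> variable_submodule A (degs (Suc i))"
proof -
  have "finite A" by simp
  then have "\<exists>g\<in>F (Suc (Suc i)). f - dif (Suc i) g \<in> variable_submodule A (degs (Suc i))"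
    using assms
  proof (induction A arbitrary: i f)
    case empty
    then have "f \<in> dif (Suc i) ` F (Suc (Suc i))"
      by (simp add: exact_Suc variable_submodule_empty)
    then obtain g where "g \<in> F (Suc (Suc i))" "f = dif (Suc i) g" by blast
    then show ?case unfolding variable_submodule_empty by (metis diff_self singletonI)
  next
    case (insert x A)
    let ?x = "free_scale (ring_var x)"
    have card: "card A \<le> i" using insert by simp
    obtain a b where a: "a \<in> variable_submodule A (degs i)" and b: "b \<in> F i"
      and ab: "dif i f = a + ?x b"
      using variable_submodule_insertE[OF insert.prems(3)] .
    \<comment> \<open>The part \<open>b\<close> of the boundary that carries \<open>x\<close> is
      itself a boundary modulo \<open>A\<close>: in positive degree it is a cycle modulo
      \<open>A\<close>, and exactness one degree lower applies.\<close>
    have "\<exists>c\<in>F (Suc i). b - dif i c \<in> variable_submodule A (degs i)"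
    proof (cases i)
      \<comment> \<open>The card bound leaves \<open>x\<close> as the only variable, and regularity
        on K[S] enters: the augmentation kills \<open>?x b\<close>, and t^(d x) can be cancelled in
        K[t].\<close>
      case 0
      then have "A = {}" using card by simp
      then have "dif i f = ?x b" using a ab by (simp add: variable_submodule_empty)
      then have "aug (?x b) = 0" using aug_dif[of f] insert.prems 0 by simp
      then have "monom 1 (d x) * aug b = 0"
        using b 0 by (simp add: aug_scale ring_var_def toric_map_single weighted_degree_single)
      then have "aug b = 0" by simp
      then have "b \<in> dif 0 ` F 1" using exact_0 b 0 by simp
      then obtain c where "c \<in> F (Suc i)" "b = dif i c" using 0 by auto
      then show ?thesis
        unfolding \<open>A = {}\<close> variable_submodule_empty by (metis diff_self singletonI)
    next
      case (Suc i')
      have "dif i' (a + ?x b) = 0"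
        using insert.prems dif_dif[of f i'] Suc ab by simp
      then have "dif i' a + ?x (dif i' b) = 0"
        using a b Suc by (simp add: dif_add dif_scale free_module_scale variable_submodule_subset)
      then have "?x (dif i' b) = - dif i' a" by (simp add: eq_neg_iff_add_eq_0 add.commute)
      moreover have "- dif i' a \<in> variable_submodule A (degs i')"
        using a Suc by (simp add: dif_variable_submodule variable_submodule_uminus)
      ultimately have "dif i' b \<in> variable_submodule A (degs i')"
        using variable_submodule_cancel_var insert.hyps(2) b Suc by (metis dif_in)
      with insert.IH[of i' b] card b Suc show ?thesis by metis
    qed
    then obtain c where c: "c \<in> F (Suc i)" "b - dif i c \<in> variable_submodule A (degs i)" by blast
    \<comment> \<open>Subtracting \<open>?x c\<close> changes \<open>f\<close> only modulo
      \<open>x\<close>, but turns its boundary into one that lies in the submodule for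
      \<open>A\<close>, so the induction hypothesis applies in the same degree
      \<open>i\<close>.\<close>
    let ?f = "f - ?x c"
    have xc: "?x c \<in> F (Suc i)" using c by (simp add: free_module_scale)
    have "dif i ?f = a + ?x (b - dif i c)"
      using c insert.prems xc
      by (simp add: dif_diff dif_scale ab) (simp add: fun_eq_iff free_scale_def algebra_simps)
    then have "dif i ?f \<in> variable_submodule A (degs i)"
      using a c by (simp add: variable_submodule_add variable_submodule_scale)
    moreover have "?f \<in> F (Suc i)" using insert.prems xc by (simp add: free_module_diff)
    ultimately obtain g where g: "g \<in> F (Suc (Suc i))"
        "?f - dif (Suc i) g \<in> variable_submodule A (degs (Suc i))"
      using insert.IH[of i ?f] le_SucI[OF card] by blast
    have "f - dif (Suc i) g = (?f - dif (Suc i) g) + ?x c" by simp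
    moreover have "?f - dif (Suc i) g \<in> variable_submodule (insert x A) (degs (Suc i))"
      using g variable_submodule_mono[of A "insert x A"] by blast
    moreover have "?x c \<in> variable_submodule (insert x A) (degs (Suc i))"
      using c by (simp add: variable_submodule_var)
    ultimately show ?case using g(1) by (metis variable_submodule_add)
  qed
  then show thesis using that by blast
qed

text \<open>A basis vector would be a cycle modulo all variables by minimality, hence a boundary
  modulo them by exactness. Boundaries have zero constant terms, again by minimality, but the basis
  vector has the constant term 1.\<close>

lemma length_of_minimal_resolution:
  assumes min: "\<And>i. dif i ` F (Suc i) \<subseteq> irrelevant_submodule (degs i)"
    and i: "CARD('n) \<le> i"
  shows "degs i = []"
proof (rule ccontr)
  assume ne: "degs i \<noteq> []"
  obtain i' where i': "i = Suc i'" using i by (cases i) auto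
  define f :: "nat \<Rightarrow> ('n, 'k) poly_ring" where "f = (\<lambda>k. if k = 0 then 1 else 0)"
  have f: "f \<in> F (Suc i')" using ne i' by (auto simp: f_def free_module_def)
  have "dif i' f \<in> variable_submodule UNIV (degs i')"
    using min[of i'] f by (auto simp: variable_submodule_UNIV)
  then obtain g where g: "g \<in> F (Suc (Suc i'))"
      "f - dif (Suc i') g \<in> variable_submodule UNIV (degs (Suc i'))"
    using exact_modulo_variables[of UNIV i' f] f i i' by auto
  have "dif (Suc i') g \<in> variable_submodule UNIV (degs (Suc i'))"
    using min[of "Suc i'"] g by (auto simp: variable_submodule_UNIV)
  with g(2) have "(f - dif (Suc i') g) + dif (Suc i') g \<in> variable_submodule UNIV (degs (Suc i'))"
    by (rule variable_submodule_add)
  then have "Poly_Mapping.lookup (f 0) 0 = 0"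
    by (simp add: variable_submodule_UNIV irrelevant_submodule_def)
  then show False by (simp add: f_def)
qed

end

subsection \<open>Dimensions of graded pieces\<close>

text \<open>The ambient spaces are infinite-dimensional, so rank-nullity is proved for a subspace
  inside a finite span. A basis of the kernel is extended to one of \<open>V\<close>, and the added
  vectors map to a basis of the image.\<close>

lemma rank_nullity_subspace:
  assumes lin: "Vector_Spaces.linear s1 s2 f"
    and V: "module.subspace s1 V"
    and fin: "finite B0" "V \<subseteq> module.span s1 B0"
  shows "vector_space.dim s1 V = vector_space.dim s1 {x \<in> V. f x = 0} + vector_space.dim s2 (f ` V)"
proof -
  interpret Vector_Spaces.linear s1 s2 f by (rule lin)
  let ?N = "{x \<in> V. f x = 0}"
  obtain A where A: "A \<subseteq> ?N" "vs1.independent A" "?N \<subseteq> vs1.span A" "card A = vs1.dim ?N"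
    using vs1.basis_exists by blast
  obtain B where B: "A \<subseteq> B" "B \<subseteq> V" "vs1.independent B" "V \<subseteq> vs1.span B"
    using vs1.maximal_independent_subset_extend[of A V] A by blast
  have finB: "finite B"
    using vs1.independent_span_bound[OF fin(1) B(3)] B(2) fin(2) by blast
  let ?C = "B - A"
  have spanC: "vs1.span ?C \<subseteq> V"
    using B(2) V by (intro vs1.span_minimal) auto
  \<comment> \<open>Such an \<open>x\<close> lies in the spans of two disjoint parts of the basis
    \<open>B\<close>; by uniqueness of coordinates all of them vanish.\<close>
  have "x = 0" if x: "x \<in> vs1.span ?C" "f x = 0" for x
  proof -
    have "x \<in> vs1.span A" using x spanC A(3) by blast
    then have "vs1.representation B x = vs1.representation A x"
      using B(1,3) by (intro vs1.representation_extend)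
    moreover have "vs1.representation B x = vs1.representation ?C x"
      using B(3) x(1) by (intro vs1.representation_extend) auto
    ultimately have "vs1.representation B x b = 0" for b
      by (metis DiffE vs1.representation_ne_zero)
    moreover have "x \<in> vs1.span B" using x(1) vs1.span_mono[of ?C B] by blast
    ultimately show ?thesis
      using vs1.sum_nonzero_representation_eq[OF B(3), of x] by simp
  qed
  then have inj: "inj_on f (vs1.span ?C)"
    unfolding inj_on_iff_eq_0[OF vs1.subspace_span] by blast
  have fA: "f a = 0" if "a \<in> A" for a using A(1) that by blast
  have "vs2.span (f ` V) = vs2.span (f ` ?C)"
  proof (rule vs2.span_eq[THEN iffD2], intro conjI)
    show "f ` ?C \<subseteq> vs2.span (f ` V)"
      using B(2) by (auto intro: vs2.span_base)
    have "f ` V \<subseteq> vs2.span (f ` B)" using B(4) spans_image by blast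
    also have "vs2.span (f ` B) \<subseteq> vs2.span (f ` ?C)"
    proof (rule vs2.span_minimal)
      show "f ` B \<subseteq> vs2.span (f ` ?C)"
        using fA by (auto intro: vs2.span_base) (metis DiffI imageI vs2.span_base vs2.span_zero)
    qed simp
    finally show "f ` V \<subseteq> vs2.span (f ` ?C)" .
  qed
  moreover have "vs2.independent (f ` ?C)"
    using independent_injective_image[OF _ inj] B(3) vs1.independent_mono by blast
  ultimately have "vs2.dim (f ` V) = card (f ` ?C)" by (metis vs2.dim_eq_card)
  also have "\<dots> = card ?C"
    using inj_on_subset[OF inj vs1.span_superset] by (rule card_image)
  finally have "vs2.dim (f ` V) = card B - card A"
    using finB B(1) by (simp add: card_Diff_subset finite_subset)
  moreover have "vs1.dim V = card B"
    using B by (intro vs1.dim_unique) auto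
  ultimately show ?thesis using A(4) card_mono[OF finB B(1)] by simp
qed

text \<open>Scalars are embedded as constant polynomials, so linearity over K is a special case of
  the module homomorphism laws.\<close>

abbreviation field_scale ::
  "'k::field \<Rightarrow> (nat \<Rightarrow> ('n::finite, 'k) poly_ring) \<Rightarrow> nat \<Rightarrow> ('n, 'k) poly_ring" where
  "field_scale c \<equiv> free_scale (Poly_Mapping.single 0 c)"

interpretation free_vs: vector_space "field_scale :: 'k::field \<Rightarrow> _ \<Rightarrow> nat \<Rightarrow> ('n::finite, 'k) poly_ring"
  by unfold_locales
    (auto intro!: ext poly_mapping_eqI
      simp: free_scale_def lookup_add distrib_left distrib_right mult.assoc)

interpretation poly_vs: vector_space "smult :: 'k::field \<Rightarrow> 'k poly \<Rightarrow> 'k poly"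
  by unfold_locales (simp_all add: smult_add_right smult_add_left)

section \<open>Monomial bases of the graded pieces\<close>

definition basis_monomial :: "nat \<times> ('n \<Rightarrow>\<^sub>0 nat) \<Rightarrow> nat \<Rightarrow> ('n::finite, 'k::field) poly_ring" where
  "basis_monomial b = (\<lambda>k. if k = fst b then Poly_Mapping.single (snd b) 1 else 0)"

definition basis_indices :: "('n::finite \<Rightarrow> nat) \<Rightarrow> nat list \<Rightarrow> nat \<Rightarrow> (nat \<times> ('n \<Rightarrow>\<^sub>0 nat)) set" where
  "basis_indices d D j = (SIGMA k:{..<length D}. {u. weighted_degree d u + D ! k = j})"

lemma basis_monomial_inj: "inj (basis_monomial :: _ \<Rightarrow> nat \<Rightarrow> ('n::finite, 'k::field) poly_ring)"
proof (rule injI)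
  fix b b' :: "nat \<times> ('n \<Rightarrow>\<^sub>0 nat)"
  assume "(basis_monomial b :: nat \<Rightarrow> ('n, 'k) poly_ring) = basis_monomial b'"
  then have "Poly_Mapping.lookup ((basis_monomial b :: nat \<Rightarrow> ('n, 'k) poly_ring) (fst b)) (snd b) =
      Poly_Mapping.lookup (basis_monomial b' (fst b)) (snd b)" by simp
  then show "b = b'"
    by (auto simp: basis_monomial_def lookup_single when_def prod_eq_iff split: if_splits)
qed

lemma lookup_scaled_basis_monomial:
  "Poly_Mapping.lookup (field_scale c (basis_monomial b) k) u = (if b = (k, u) then c else 0)"
  by (auto simp: free_scale_def basis_monomial_def lookup_single when_def)

lemma finite_basis_indices:
  assumes "\<And>i. 0 < d i"
  shows "finite (basis_indices d D j)"
proof -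
  have "finite {u. weighted_degree d u + D ! k = j}" for k
    by (rule finite_subset[OF _ finite_monomials_of_degree[of d UNIV "j - D ! k", OF assms]])
      (auto simp: monomials_of_degree_def)
  then show ?thesis by (simp add: basis_indices_def)
qed

lemma free_module_part_subspace:
  "free_vs.subspace (free_module_part d D j :: (nat \<Rightarrow> ('n::finite, 'k::field) poly_ring) set)"
proof -
  have "Poly_Mapping.keys (Poly_Mapping.single 0 c * p) \<subseteq> Poly_Mapping.keys p"
    for c and p :: "('n, 'k) poly_ring" by (auto simp: in_keys_iff)
  moreover have "Poly_Mapping.keys (p + q) \<subseteq> Poly_Mapping.keys p \<union> Poly_Mapping.keys q"
    for p q :: "('n, 'k) poly_ring" by (rule keys_add)
  ultimately show ?thesis
    unfolding free_vs.subspace_def free_module_part_def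
    by (fastforce simp: free_module_add free_module_scale free_scale_def free_module_def)
qed

lemma free_module_part_eq_sum:
  assumes pos: "\<And>i. 0 < d i" and f: "f \<in> free_module_part d D j"
  shows "f = (\<Sum>b\<in>basis_indices d D j.
    field_scale (Poly_Mapping.lookup (f (fst b)) (snd b)) (basis_monomial b))"
proof (rule ext, rule poly_mapping_eqI)
  fix k u
  have "Poly_Mapping.lookup (f k) u = 0" if "(k, u) \<notin> basis_indices d D j"
  proof (rule ccontr)
    assume ne: "Poly_Mapping.lookup (f k) u \<noteq> 0"
    then have "k < length D"
      using f by (auto simp: free_module_part_def free_module_def not_less[symmetric])
    then show False
      using that f ne by (auto simp: free_module_part_def in_keys_iff basis_indices_def)
  qed
  then show "Poly_Mapping.lookup (f k) u = Poly_Mapping.lookup ((\<Sum>b\<in>basis_indices d D j.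
    field_scale (Poly_Mapping.lookup (f (fst b)) (snd b)) (basis_monomial b)) k) u"
    using finite_basis_indices[of d D j, OF pos]
    by (auto simp: sum_fun_apply lookup_sum lookup_scaled_basis_monomial)
qed

lemma basis_monomial_in_part: "basis_monomial ` basis_indices d D j \<subseteq> free_module_part d D j"
  by (auto simp: basis_monomial_def basis_indices_def free_module_part_def free_module_def
      split: if_splits)

lemma free_module_part_span:
  assumes "\<And>i. 0 < d i"
  shows "free_module_part d D j \<subseteq>
    free_vs.span (basis_monomial ` basis_indices d D j :: (nat \<Rightarrow> ('n::finite, 'k::field) poly_ring) set)"
proof
  fix f :: "nat \<Rightarrow> ('n, 'k) poly_ring"
  assume f: "f \<in> free_module_part d D j"
  show "f \<in> free_vs.span (basis_monomial ` basis_indices d D j)"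
    by (subst free_module_part_eq_sum[of d, OF assms f])
      (intro free_vs.span_sum free_vs.span_scale free_vs.span_base imageI)
qed

lemma dim_free_module_part:
  assumes pos: "\<And>i. 0 < d i"
  shows "free_vs.dim (free_module_part d D j :: (nat \<Rightarrow> ('n::finite, 'k::field) poly_ring) set) =
    card (basis_indices d D j)"
proof (rule free_vs.dim_unique)
  let ?b = "basis_monomial :: _ \<Rightarrow> nat \<Rightarrow> ('n, 'k) poly_ring"
  let ?I = "basis_indices d D j"
  note inj = inj_on_subset[OF basis_monomial_inj subset_UNIV]
  show "?b ` ?I \<subseteq> free_module_part d D j"
    by (rule basis_monomial_in_part)
  show "free_module_part d D j \<subseteq> free_vs.span (?b ` ?I)"
    by (rule free_module_part_span) (rule pos)
  show "card (?b ` ?I) = card ?I"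
    by (rule card_image) (rule inj)
  have fin: "finite ?I" by (rule finite_basis_indices) (rule pos)
  show "free_vs.independent (?b ` ?I)"
  proof (rule free_vs.independent_if_scalars_zero)
    fix c :: "(nat \<Rightarrow> ('n, 'k) poly_ring) \<Rightarrow> 'k" and x
    assume zero: "(\<Sum>x\<in>?b ` ?I. field_scale (c x) x) = 0" and "x \<in> ?b ` ?I"
    then obtain k u where x: "x = ?b (k, u)" "(k, u) \<in> ?I" by auto
    have "(\<Sum>b\<in>?I. field_scale (c (?b b)) (?b b)) = 0"
      using zero by (simp add: sum.reindex[OF inj])
    then have "Poly_Mapping.lookup ((\<Sum>b\<in>?I. field_scale (c (?b b)) (?b b)) k) u = 0" by simp
    then show "c x = 0"
      using fin x by (simp add: sum_fun_apply lookup_sum lookup_scaled_basis_monomial)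
  qed (use fin in simp)
qed

lemma card_basis_indices:
  assumes pos: "\<And>i. 0 < d i"
  shows "card (basis_indices d D j) = (\<Sum>k<length D.
    if D ! k \<le> j then card (monomials_of_degree d UNIV (j - D ! k)) else 0)"
proof -
  have eq: "{u. weighted_degree d u + D ! k = j} =
      (if D ! k \<le> j then monomials_of_degree d UNIV (j - D ! k) else {})" for k
    by (auto simp: monomials_of_degree_def)
  show ?thesis
    unfolding basis_indices_def
    by (subst card_SigmaI) (auto simp: eq finite_monomials_of_degree[of d, OF pos] intro!: sum.cong)
qed

text \<open>The projection onto degree \<open>j\<close>. It turns an arbitrary preimage of a
  homogeneous element into a homogeneous one, so that exactness passes to each degree.\<close>

definition degree_component ::
  "('n::finite \<Rightarrow> nat) \<Rightarrow> nat list \<Rightarrow> nat \<Rightarrow> (nat \<Rightarrow> ('n, 'k::field) poly_ring) \<Rightarrow> nat \<Rightarrow> ('n, 'k) poly_ring" where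
  "degree_component d D j f = (\<lambda>k. \<Sum>u\<in>{u \<in> Poly_Mapping.keys (f k). weighted_degree d u + D ! k = j}.
     Poly_Mapping.single u (Poly_Mapping.lookup (f k) u))"

lemma lookup_degree_component:
  "Poly_Mapping.lookup (degree_component d D j f k) u =
     (if weighted_degree d u + D ! k = j then Poly_Mapping.lookup (f k) u else 0)"
  by (auto simp: degree_component_def lookup_sum lookup_single when_def in_keys_iff)

lemma degree_component_add:
  "degree_component d D j (f + g) = degree_component d D j f + degree_component d D j g"
  by (intro ext poly_mapping_eqI) (simp add: lookup_degree_component lookup_add)

lemma degree_component_0: "degree_component d D j 0 = 0"
  by (simp add: degree_component_def fun_eq_iff)

lemma degree_component_sum:
  "degree_component d D j (\<Sum>l\<in>L. g l) = (\<Sum>l\<in>L. degree_component d D j (g l))"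
  by (induction L rule: infinite_finite_induct)
    (simp_all only: simp_thms if_False sum.infinite sum.empty sum.insert degree_component_0 degree_component_add)

lemma degree_component_in_part:
  assumes "f \<in> free_module D"
  shows "degree_component d D j f \<in> free_module_part d D j"
proof -
  have "degree_component d D j f \<in> free_module D"
    using assms by (simp add: free_module_def degree_component_def)
  then show ?thesis
    by (auto simp: free_module_part_def in_keys_iff lookup_degree_component split: if_splits)
qed

lemma degree_component_of_part:
  assumes "f \<in> free_module_part d D l"
  shows "degree_component d D j f = (if l = j then f else 0)"
proof (intro ext poly_mapping_eqI)
  fix k u
  show "Poly_Mapping.lookup (degree_component d D j f k) u = Poly_Mapping.lookup ((if l = j then f else 0) k) u"
  proof (cases "Poly_Mapping.lookup (f k) u = 0")
    case False
    then have "k < length D"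
      using assms by (auto simp: free_module_part_def free_module_def not_less[symmetric])
    then have "weighted_degree d u + D ! k = l"
      using assms False by (auto simp: free_module_part_def in_keys_iff)
    then show ?thesis by (auto simp: lookup_degree_component)
  qed (simp add: lookup_degree_component)
qed

lemma free_module_part_subset: "f \<in> free_module_part d D j \<Longrightarrow> f \<in> free_module D"
  by (simp add: free_module_part_def)

lemma sum_of_degree_components:
  assumes "f \<in> free_module D"
  obtains L where "finite L" "f = (\<Sum>l\<in>L. degree_component d D l f)"
proof
  let ?L = "\<Union>k<length D. (\<lambda>u. weighted_degree d u + D ! k) ` Poly_Mapping.keys (f k)"
  show fin: "finite ?L" by auto
  show "f = (\<Sum>l\<in>?L. degree_component d D l f)"
  proof (rule ext, rule poly_mapping_eqI)
    fix k u
    have "weighted_degree d u + D ! k \<in> ?L" if "Poly_Mapping.lookup (f k) u \<noteq> 0"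
    proof -
      have "k < length D"
        using that assms by (auto simp: free_module_def not_less[symmetric])
      then show ?thesis using that unfolding in_keys_iff[symmetric] by blast
    qed
    then show "Poly_Mapping.lookup (f k) u =
        Poly_Mapping.lookup ((\<Sum>l\<in>?L. degree_component d D l f) k) u"
      using fin by (auto simp: sum_fun_apply lookup_sum lookup_degree_component)
  qed
qed

(* pr plays the role of the projection of the target onto its degree j piece *)
lemma hom_degree_component:
  fixes h :: "(nat \<Rightarrow> ('n::finite, 'k::field) poly_ring) \<Rightarrow> 'b::ab_group_add"
  assumes add: "\<And>f g. f \<in> free_module D \<Longrightarrow> g \<in> free_module D \<Longrightarrow> h (f + g) = h f + h g"
    and h_part: "\<And>f l. f \<in> free_module_part d D l \<Longrightarrow> h f \<in> Nj l"
    and pr_add: "\<And>x y. pr (x + y) = pr x + pr y"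
    and pr_part: "\<And>x l. x \<in> Nj l \<Longrightarrow> pr x = (if l = j then x else (0::'b))"
    and f: "f \<in> free_module D" "h f \<in> Nj j"
  shows "h (degree_component d D j f) = h f"
proof -
  let ?c = "\<lambda>l. degree_component d D l f"
  have c: "?c l \<in> free_module D" for l
    using degree_component_in_part[OF f(1)] free_module_part_subset by blast
  have h0: "h 0 = 0" using add[of 0 0] by simp
  have pr0: "pr 0 = 0" using pr_add[of 0 0] by simp
  have pr_c: "pr (h (?c l)) = (if l = j then h (?c l) else 0)" for l
    using pr_part h_part degree_component_in_part[OF f(1)] by blast
  have sum: "(\<Sum>l\<in>L. ?c l) \<in> free_module D \<and> pr (h (\<Sum>l\<in>L. ?c l)) = (\<Sum>l\<in>L. pr (h (?c l)))"
    if "finite L" for L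
    using that
  proof induction
    case empty
    then show ?case by (simp only: sum.empty free_module_0 h0 pr0 simp_thms)
  next
    case (insert l L)
    have "(\<Sum>l\<in>insert l L. ?c l) = ?c l + (\<Sum>l\<in>L. ?c l)" using insert.hyps by (rule sum.insert)
    then show ?case
      using insert c[of l] by (simp only: free_module_add add pr_add sum.insert simp_thms if_False)
  qed
  obtain L where L: "finite L" "f = (\<Sum>l\<in>L. ?c l)"
    using sum_of_degree_components[OF f(1)] .
  \<comment> \<open>If \<open>j\<close> is missing from \<open>L\<close>, the component of degree
    \<open>j\<close> is zero; adding it ensures that the sum below has a term at \<open>j\<close> to
    pick out.\<close>
  have "f = (\<Sum>l\<in>insert j L. ?c l)"
  proof (cases "j \<in> L")
    case True
    then show ?thesis using L by (simp add: insert_absorb)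
  next
    case False
    have "?c j = (\<Sum>l\<in>L. degree_component d D j (?c l))"
      using L(2) degree_component_sum by metis
    also have "\<dots> = 0"
      using False by (intro sum.neutral ballI)
        (auto simp: degree_component_of_part[OF degree_component_in_part[OF f(1)]])
    finally have "?c j = 0" .
    then show ?thesis using L False by simp
  qed
  then have "pr (h f) = (\<Sum>l\<in>insert j L. pr (h (?c l)))"
    using sum[of "insert j L"] L(1) by simp
  also have "\<dots> = h (?c j)"
    unfolding pr_c using L(1) by (simp add: sum.delta)
  finally show ?thesis using pr_part[OF f(2)] by simp
qed

subsection \<open>The K-polynomial of the resolution\<close>

text \<open>\<open>Vector_Spaces.linear\<close> asks for linearity on a whole type, but
  \<open>aug\<close> and \<open>dif i\<close> are homomorphisms only on the free modules. Composed
  with this projection they are linear everywhere and unchanged where it matters.\<close>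

definition truncate :: "nat list \<Rightarrow> (nat \<Rightarrow> ('n::finite, 'k::field) poly_ring) \<Rightarrow> nat \<Rightarrow> ('n, 'k) poly_ring" where
  "truncate D f = (\<lambda>k. if k < length D then f k else 0)"

lemma truncate_in: "truncate D f \<in> free_module D"
  by (simp add: truncate_def free_module_def)

lemma truncate_id: "f \<in> free_module D \<Longrightarrow> truncate D f = f"
  by (auto simp: truncate_def free_module_def)

lemma truncate_add: "truncate D (f + g) = truncate D f + truncate D g"
  by (auto simp: truncate_def)

lemma truncate_scale: "truncate D (free_scale r f) = free_scale r (truncate D f)"
  by (auto simp: truncate_def free_scale_def)

lemma dim_semigroup_algebra_part:
  "poly_vs.dim (semigroup_algebra_part S j :: 'k::field poly set) = (if j \<in> S then 1 else 0)"
proof -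
  have eq: "semigroup_algebra_part S j = (if j \<in> S then range (\<lambda>c::'k. smult c (monom 1 j)) else {0})"
  proof -
    have "p = smult (coeff p j) (monom 1 j)" if "\<forall>s. coeff p s \<noteq> 0 \<longrightarrow> s = j" for p :: "'k poly"
      using that by (intro poly_eqI) auto
    then have "semigroup_algebra_part S j \<subseteq> (if j \<in> S then range (\<lambda>c::'k. smult c (monom 1 j)) else {0})"
      by (fastforce simp: semigroup_algebra_part_def semigroup_algebra_def intro: poly_eqI)
    then show ?thesis
      by (auto simp: semigroup_algebra_part_def semigroup_algebra_def split: if_splits)
  qed
  show ?thesis
  proof (cases "j \<in> S")
    case True
    then have "semigroup_algebra_part S j = poly_vs.span {monom (1::'k) j}"
      by (simp add: eq poly_vs.span_singleton)
    moreover have "poly_vs.independent {monom (1::'k) j}"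
      by (simp add: poly_vs.dependent_single)
    ultimately show ?thesis using True by (simp add: poly_vs.dim_eq_card_independent)
  next
    case False
    then have "semigroup_algebra_part S j = {0::'k poly}" by (simp add: eq)
    moreover have "poly_vs.dim {0::'k poly} = card {}"
      by (rule poly_vs.dim_unique) (auto simp: poly_vs.independent_empty)
    ultimately show ?thesis using False by simp
  qed
qed

text \<open>In use \<open>a i\<close> is the dimension of a graded piece of F_i, \<open>b i\<close>
  that of its cycles, which is also that of the boundaries coming from F_(i+1), and \<open>s\<close>
  that of the piece of K[S].\<close>

lemma alternating_sum_telescope:
  fixes a b :: "nat \<Rightarrow> int"
  assumes "a 0 = b 0 + s" "\<And>i. a (Suc i) = b (Suc i) + b i"
  shows "(\<Sum>i<Suc n. (-1) ^ i * a i) = s + (-1) ^ n * b n"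
  using assms by (induction n) (auto simp: algebra_simps)

lemma sum_list_eq_sum_count_list:
  fixes f :: "'a \<Rightarrow> 'b::comm_semiring_1"
  shows "(\<Sum>x\<leftarrow>xs. f x) = (\<Sum>x\<in>set xs. of_nat (count_list xs x) * f x)"
proof (induction xs)
  case Nil
  then show ?case by simp
next
  case (Cons a xs)
  have "(\<Sum>x\<in>set xs. of_nat (count_list xs x) * f x) = (\<Sum>x\<in>set (a # xs). of_nat (count_list xs x) * f x)"
    by (rule sum.mono_neutral_left) (auto simp: count_list_0_iff)
  moreover have "f a = (\<Sum>x\<in>set (a # xs). if x = a then f x else 0)"
    by simp
  ultimately have "(\<Sum>x\<leftarrow>a # xs. f x) =
      (\<Sum>x\<in>set (a # xs). (if x = a then f x else 0) + of_nat (count_list xs x) * f x)"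
    using Cons by (simp only: sum_list.Cons list.map sum.distrib)
  also have "\<dots> = (\<Sum>x\<in>set (a # xs). of_nat (count_list (a # xs) x) * f x)"
    by (rule sum.cong) (auto simp: algebra_simps)
  finally show ?case .
qed

context toric_resolution
begin

abbreviation "Fdim i j \<equiv> card (basis_indices d (degs i) j)"

lemma aug_image_part: "aug ` Fpart 0 j = semigroup_algebra_part S j"
proof (rule subset_antisym)
  show "aug ` Fpart 0 j \<subseteq> semigroup_algebra_part S j" using aug_part by blast
  show "semigroup_algebra_part S j \<subseteq> aug ` Fpart 0 j"
  proof
    fix y :: "'k poly"
    assume y: "y \<in> semigroup_algebra_part S j"
    then obtain f where f: "f \<in> F 0" "y = aug f"
      using aug_surj by (force simp: semigroup_algebra_part_def)
    have pr: "monom (coeff x j) j = (if l = j then x else 0)"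
      if "x \<in> semigroup_algebra_part S l" for x :: "'k poly" and l
      using that by (intro poly_eqI) (auto simp: semigroup_algebra_part_def)
    have "aug (degree_component d (degs 0) j f) = aug f"
      by (rule hom_degree_component[where h = aug and pr = "\<lambda>x. monom (coeff x j) j" and Nj = "semigroup_algebra_part S"])
        (use f y pr in \<open>auto simp: aug_add aug_part add_monom\<close>)
    then show "y \<in> aug ` Fpart 0 j"
      using degree_component_in_part[OF f(1)] f(2) by (metis imageI)
  qed
qed

text \<open>The predicate \<open>P\<close> covers both kinds of cycles: the kernel of
  \<open>aug\<close> in homological degree 0 and the kernel of a differential above it.\<close>

lemma dif_image_part:
  assumes exact: "dif i ` F (Suc i) = {f \<in> F i. P f}"
  shows "dif i ` Fpart (Suc i) j = {f \<in> Fpart i j. P f}"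
proof (rule subset_antisym)
  show "dif i ` Fpart (Suc i) j \<subseteq> {f \<in> Fpart i j. P f}"
    using dif_part exact free_module_part_subset by blast
  show "{f \<in> Fpart i j. P f} \<subseteq> dif i ` Fpart (Suc i) j"
  proof
    fix y assume y: "y \<in> {f \<in> Fpart i j. P f}"
    then obtain f where f: "f \<in> F (Suc i)" "y = dif i f"
      using exact free_module_part_subset by blast
    have "dif i (degree_component d (degs (Suc i)) j f) = dif i f"
      by (rule hom_degree_component[where h = "dif i" and pr = "degree_component d (degs i) j" and Nj = "Fpart i"])
        (use f y in \<open>auto simp only: dif_add dif_part degree_component_add degree_component_of_part mem_Collect_eq\<close>)
    then show "y \<in> dif i ` Fpart (Suc i) j"
      using degree_component_in_part[OF f(1)] f(2) by (metis imageI)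
  qed
qed

lemma toric_map_const: "toric_map d (Poly_Mapping.single 0 c) * p = smult c p"
  by (simp add: toric_map_single monom_0)

lemma Fpart_truncate: "f \<in> Fpart i j \<Longrightarrow> truncate (degs i) f = f"
  by (intro truncate_id free_module_part_subset)

lemma dim_F0:
  assumes pos: "\<And>i. 0 < d i"
  shows "Fdim 0 j = free_vs.dim {f \<in> Fpart 0 j. aug f = 0} + (if j \<in> S then 1 else 0)"
proof -
  let ?h = "\<lambda>f. aug (truncate (degs 0) f)"
  have "Vector_Spaces.linear field_scale smult ?h"
    by unfold_locales
      (simp_all add: truncate_add truncate_scale aug_add aug_scale truncate_in toric_map_const)
  then have "free_vs.dim (Fpart 0 j :: (nat \<Rightarrow> ('n, 'k) poly_ring) set) = free_vs.dim {f \<in> Fpart 0 j. ?h f = 0} + poly_vs.dim (?h ` Fpart 0 j)"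
    by (rule rank_nullity_subspace[OF _ free_module_part_subspace
          finite_imageI[OF finite_basis_indices[of d, OF pos]] free_module_part_span[of d, OF pos]])
  moreover have "{f \<in> Fpart 0 j. ?h f = 0} = {f \<in> Fpart 0 j. aug f = 0}"
    using Fpart_truncate by (metis (lifting))
  moreover have "?h ` Fpart 0 j = semigroup_algebra_part S j"
    using Fpart_truncate aug_image_part by (metis (lifting) image_cong)
  ultimately show ?thesis
    by (simp add: dim_semigroup_algebra_part dim_free_module_part[of d, OF pos])
qed

lemma dim_F_Suc:
  assumes pos: "\<And>i. 0 < d i"
  shows "Fdim (Suc i) j = free_vs.dim {f \<in> Fpart (Suc i) j. dif i f = 0} + free_vs.dim (dif i ` Fpart (Suc i) j)"
proof -
  let ?h = "\<lambda>f. dif i (truncate (degs (Suc i)) f)"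
  have "Vector_Spaces.linear field_scale field_scale ?h"
    by unfold_locales
      (simp_all only: truncate_add truncate_scale dif_add dif_scale truncate_in)
  then have "free_vs.dim (Fpart (Suc i) j :: (nat \<Rightarrow> ('n, 'k) poly_ring) set) = free_vs.dim {f \<in> Fpart (Suc i) j. ?h f = 0} + free_vs.dim (?h ` Fpart (Suc i) j)"
    by (rule rank_nullity_subspace[OF _ free_module_part_subspace
          finite_imageI[OF finite_basis_indices[of d, OF pos]] free_module_part_span[of d, OF pos]])
  moreover have "{f \<in> Fpart (Suc i) j. ?h f = 0} = {f \<in> Fpart (Suc i) j. dif i f = 0}"
    using Fpart_truncate by (metis (lifting))
  moreover have "?h ` Fpart (Suc i) j = dif i ` Fpart (Suc i) j"
    using Fpart_truncate by (metis (lifting) image_cong)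
  ultimately show ?thesis by (simp add: dim_free_module_part[of d, OF pos])
qed

lemma alternating_dim_sum:
  assumes pos: "\<And>i. 0 < d i" and last: "degs (Suc n) = []"
  shows "(\<Sum>i<Suc n. (-1) ^ i * int (Fdim i j)) = (if j \<in> S then 1 else 0)"
proof -
  define b where "b i = free_vs.dim (if i = 0 then {f \<in> Fpart 0 j. aug f = 0}
    else {f \<in> Fpart i j. dif (i - 1) f = 0})" for i
  have "Fdim 0 j = b 0 + (if j \<in> S then 1 else 0)"
    using dim_F0[OF pos] by (simp add: b_def)
  moreover have im: "b i = free_vs.dim (dif i ` Fpart (Suc i) j)" for i
    using dif_image_part[OF exact_Suc] dif_image_part[of 0] exact_0
    by (cases i) (simp_all add: b_def)
  then have "Fdim (Suc i) j = b (Suc i) + b i" for i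
    using dim_F_Suc[OF pos] by (simp add: b_def)
  ultimately have "(\<Sum>i<Suc n. (-1) ^ i * int (Fdim i j)) =
      (if j \<in> S then 1 else 0) + (-1) ^ n * int (b n)"
    by (intro alternating_sum_telescope[where b = "\<lambda>i. int (b i)"]) auto
  moreover have "Fdim (Suc n) j = 0"
    using last by (simp add: basis_indices_def)
  \<comment> \<open>\<open>b n\<close> is a summand of the dimension of a piece of the zero module
    F_(n+1), so the telescoped sum has no remainder.\<close>
  then have "b n = 0" using \<open>\<And>i. Fdim (Suc i) j = b (Suc i) + b i\<close> by simp
  ultimately show ?thesis by simp
qed

text \<open>The K-polynomial, summed over basis vectors so that the Betti numbers appear as
  repetitions of a degree.\<close>

definition numerator :: "nat \<Rightarrow> int poly" where
  "numerator m = (\<Sum>i<m. \<Sum>k<length (degs i). monom ((-1) ^ i) (degs i ! k))"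

text \<open>A basis vector of degree e contributes to degree \<open>j\<close> as many basis elements
  as there are monomials of degree \<open>j\<close> - e. The coefficients of the product are thus
  the alternating sums of the dimensions of the pieces.\<close>

lemma numerator_hilbert_series:
  assumes pos: "\<And>i. 0 < d i" and last: "degs (Suc n) = []"
  shows "fps_of_poly (numerator (Suc n)) * Abs_fps (\<lambda>n. int (card (monomials_of_degree d UNIV n))) =
    Abs_fps (\<lambda>j. if j \<in> S then 1 else 0)"
proof (rule fps_ext)
  fix j
  let ?H = "Abs_fps (\<lambda>n. int (card (monomials_of_degree d UNIV n)))"
  have "fps_nth (fps_of_poly (numerator (Suc n)) * ?H) j =
      (\<Sum>i<Suc n. \<Sum>k<length (degs i). (-1) ^ i *
        (if degs i ! k \<le> j then int (card (monomials_of_degree d UNIV (j - degs i ! k))) else 0))"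
    unfolding numerator_def
    by (simp add: fps_of_poly_sum fps_of_poly_monom sum_distrib_right fps_sum_nth mult.assoc
      fps_X_power_mult_nth not_less del: sum.lessThan_Suc cong: if_cong)
      (intro sum.cong refl, auto)
  also have "\<dots> = (\<Sum>i<Suc n. (-1) ^ i * int (Fdim i j))"
    unfolding card_basis_indices[of d, OF pos] sum_distrib_left of_nat_sum
    by (intro sum.cong refl) auto
  also have "\<dots> = (if j \<in> S then 1 else 0)"
    by (rule alternating_dim_sum[OF pos last])
  finally show "fps_nth (fps_of_poly (numerator (Suc n)) * ?H) j = fps_nth (Abs_fps (\<lambda>j. if j \<in> S then 1 else 0)) j"
    by simp
qed

text \<open>The \<open>r\<close>-th Euler iterate multiplies t^j by j^r, with 0^0 = 1 as in the
  statement to be proved.\<close>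

lemma betti_moment:
  "(\<Sum>i<m. \<Sum>j | graded_betti degs i j \<noteq> 0. (-1) ^ i * int (graded_betti degs i j) * int j ^ r) =
    poly ((euler_op ^^ r) (numerator m)) 1"
proof -
  have "(\<Sum>j | graded_betti degs i j \<noteq> 0. (-1) ^ i * int (graded_betti degs i j) * int j ^ r) =
      (\<Sum>k<length (degs i). int (degs i ! k) ^ r * (-1) ^ i)" for i
  proof -
    have "(\<Sum>k<length (degs i). int (degs i ! k) ^ r * (-1) ^ i) = (\<Sum>j\<leftarrow>degs i. int j ^ r * (-1) ^ i)"
      by (simp add: sum_list_sum_nth atLeast0LessThan)
    also have "\<dots> = (\<Sum>j\<in>set (degs i). int (count_list (degs i) j) * (int j ^ r * (-1) ^ i))"
      by (rule sum_list_eq_sum_count_list)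
    finally show ?thesis by (simp add: graded_betti_def count_list_0_iff mult_ac)
  qed
  then show ?thesis
    by (simp add: numerator_def euler_op_funpow_sum euler_op_funpow_monom poly_sum poly_monom)
qed

end

theorem theorem2p1:
  fixes d :: "'n::{finite,linorder} \<Rightarrow> nat"
    and degs :: "nat \<Rightarrow> nat list"
    and aug :: "(nat \<Rightarrow> ('n, 'k::field) poly_ring) \<Rightarrow> 'k poly"
    and dif :: "nat \<Rightarrow> (nat \<Rightarrow> ('n, 'k) poly_ring) \<Rightarrow> (nat \<Rightarrow> ('n, 'k) poly_ring)"
    and m :: nat
  assumes "m = CARD('n)"
    and "strict_mono d"
    and "minimal_generators d"
    and "Gcd (range d) = 1"
    and "minimal_graded_free_resolution d degs aug dif"
  shows "(\<forall>r::nat. r + 2 \<le> m \<longrightarrow>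
            (\<Sum>i<m. \<Sum>j | graded_betti degs i j \<noteq> 0.
               (-1) ^ i * int (graded_betti degs i j) * int j ^ r) = 0) \<and>
         (\<Sum>i<m. \<Sum>j | graded_betti degs i j \<noteq> 0.
            (-1) ^ i * int (graded_betti degs i j) * int j ^ (m - 1)) =
           (-1) ^ (m - 1) * fact (m - 1) * (\<Prod>i\<in>UNIV. int (d i))"
proof -
  interpret toric_resolution d degs aug dif
    using assms(5) by unfold_locales (simp add: minimal_graded_free_resolution_def)
  have pos: "0 < d i" for i using assms(3) by (simp add: minimal_generators_def)
  obtain n where n: "m = Suc n" using assms(1) gr0_implies_Suc[of m] by auto
  have "degs m = []"
    using assms(1,5) by (intro length_of_minimal_resolution)
      (auto simp: minimal_graded_free_resolution_def)
  then have hilb: "fps_of_poly (numerator m) * Abs_fps (\<lambda>n. int (card (monomials_of_degree d UNIV n))) =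
      Abs_fps (\<lambda>j. if j \<in> S then 1 else 0)"
    unfolding n by (intro numerator_hilbert_series pos)
  obtain N where "\<And>k. N \<le> k \<Longrightarrow> k \<in> S"
    using generated_semigroup_cofinite[OF assms(4)] by blast
  then obtain Q where "numerator m = [:1, -1:] ^ (m - 1) * Q" "poly Q 1 = (\<Prod>i\<in>UNIV. int (d i))"
    using numerator_factorization[of d N S, OF pos _ hilb] assms(1) by blast
  then show ?thesis
    unfolding betti_moment by (auto simp: poly_euler_op_funpow_at_1)
qed

end
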